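(* Let $x(t)$, $t\in\{0,1,2,\dots\}$, be a trajectory of an SBC or SBI system with bounds vector $r\in\mathbb{R}^n_{>0}$. Assume that there exists an equilibrium opinion vector $z\in\mathbb{R}^n$ of the system such that $x(0)\in\mathbb{R}^n$ belongs to the invariant equi-topology neighborhood $\mathcal{B}_{\mathrm{iet}}(z)$ of $z$. Then, for all $t\ge 0$: (i) $x(t)$ takes value in the equi-topology neighborhood $\mathcal{B}_{\mathrm{et}}(z)$ of $z$, and hence $G_r(z)=G_r(x(t))$; (ii) $G_r(x(t))$ contains no moderate-minded component; and (iii) $x(t)$ converges to $\operatorname{fvct}(x(0))$ as time goes to infinity.
   Context: There are $n$ agents with opinion vector $y\in\mathbb{R}^n$ and a fixed bounds vector $r\in\mathbb{R}^n_{>0}$. To $y$ one associates a proximity digraph $G_r(y)$ with nodes $\{1,\dots,n\}$, where the set of out-neighbors of node $i$ is: in the synchronized bounded confidence (SBC) case $\mathcal{N}_i(y)=\{j: |y_i-y_j|\le r_i\}$; in the synchronized bounded influence (SBI) case $\mathcal{N}_i(y)=\{j: |y_i-y_j|\le r_j\}$ (so $i\in\mathcal{N}_i(y)$ always). $G_r(y)$ denotes either of the two digraphs, the same choice throughout. The adjacency matrix $A(y)\in\mathbb{R}^{n\times n}$ has entries $a_{ij}(y)=1/|\mathcal{N}_i(y)|$ if $j\in\mathcal{N}_i(y)$ and $0$ otherwise. The SBC (resp. SBI) system is $x(t+1)=A(x(t))x(t)$. An opinion vector $y_0$ is an equilibrium opinion vector if $y_0=A(y_0)y_0$. The final value at constant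 topology of $y$ is $\operatorname{fvct}(y)=\lim_{t\to\infty}A(y)^t y$. The condensation digraph $C(G)$ of a digraph $G$ has as nodes the strongly connected components (SCCs) of $G$, with an edge from $H_1$ to $H_2$ ($H_1\neq H_2$) iff $G$ has an edge from a node of $H_1$ to a node of $H_2$; a sink is a node with out-degree zero. An SCC of $G_r(y)$ is a moderate-minded component if it is a non-complete subgraph of $G_r(y)$ and corresponds to a sink of $C(G_r(y))$ (complete: every node of it has an edge to every node of it). Node $j$ is a predecessor of node $i$ if there is a directed path from $j$ to $i$; because of self-loops each node is a predecessor of itself. The equi-topology distance of $z\in\mathbb{R}^n$ is the vector $\epsilon(z)\in\mathbb{R}^n_{\ge0}$ with $\epsilon_i(z)=0.5\min\{\,\big||z_i-z_j|-R\big| : j\in\{1,\dots,n\}\setminus\{i\},\ R\in\{r_i,r_j\}\}$. The equi-topology neighborhood $\mathcal{B}_{\mathrm{et}}(z)$ is the set of $y\in\mathbb{R}^n$ such that for every $i$: $|y_i-z_i|<\epsilon_i(z)$ if $\epsilon_i(z)>0$, and $|y_i-z_i|=\epsilon_i(z)$ if $\epsilon_i(z)=0$. The invariant equi-topology distance of $z$ is the vector $\delta(z)\in\mathbb{R}^n_{\ge0}$ with $\delta_i(z)=\min\{\epsilon_j(z): j \text{ is a predecessor of } i \text{ in } G_r(z)\}$. The invariant equi-topology neighborhood $\mathcal{B}_{\mathrm{iet}}(z)$ is the set of $y\in\mathbb{R}^n$ such that for every $i$: $|y_i-z_i|<\delta_i(z)$ if $\delta_i(z)>0$, and $|y_i-z_i|=\delta_i(z)$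 if $\delta_i(z)=0$. *)

theory Defs
  imports "HOL-Analysis.Analysis" "Graph_Theory.Digraph_Component"
begin

text \<open>
  The agents are the elements of a finite type \<open>'n\<close>, so that opinion vectors live in
  \<open>real ^ 'n\<close> with \<open>n = CARD('n)\<close>. The two systems are told apart by a tag, which is passed to
  every notion that depends on the proximity digraph.
\<close>

datatype sync_system = SBC | SBI

definition out_neighbors :: "sync_system \<Rightarrow> real ^ 'n \<Rightarrow> real ^ 'n \<Rightarrow> 'n \<Rightarrow> 'n::finite set" where
  "out_neighbors s r y i =
    (case s of
       SBC \<Rightarrow> {j. \<bar>y $ i - y $ j\<bar> \<le> r $ i}
     | SBI \<Rightarrow> {j. \<bar>y $ i - y $ j\<bar> \<le> r $ j})"

definition proximity_digraph ::
    "sync_system \<Rightarrow> real ^ 'n \<Rightarrow> real ^ 'n \<Rightarrow> 'n::finite pair_pre_digraph" where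
  "proximity_digraph s r y =
    \<lparr>pverts = UNIV, parcs = {(i, j). j \<in> out_neighbors s r y i}\<rparr>"

definition adjacency :: "sync_system \<Rightarrow> real ^ 'n \<Rightarrow> real ^ 'n \<Rightarrow> real ^ 'n ^ 'n::finite" where
  "adjacency s r y =
    (\<chi> i j. if j \<in> out_neighbors s r y i then 1 / real (card (out_neighbors s r y i)) else 0)"

definition trajectory ::
    "sync_system \<Rightarrow> real ^ 'n \<Rightarrow> (nat \<Rightarrow> real ^ 'n::finite) \<Rightarrow> bool" where
  "trajectory s r x \<longleftrightarrow> (\<forall>t. x (Suc t) = adjacency s r (x t) *v x t)"

definition equilibrium :: "sync_system \<Rightarrow> real ^ 'n \<Rightarrow> real ^ 'n::finite \<Rightarrow> bool" where
  "equilibrium s r y \<longleftrightarrow> y = adjacency s r y *v y"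

text \<open>
  The library's product on \<open>real ^ 'n ^ 'n\<close> is componentwise, hence so is its power operation;
  powers of a matrix are therefore taken with respect to \<open>**\<close>.
\<close>

definition matrix_power :: "real ^ 'n ^ 'n \<Rightarrow> nat \<Rightarrow> real ^ 'n ^ 'n::finite" where
  "matrix_power A t = (((**) A) ^^ t) (mat 1)"

definition fvct :: "sync_system \<Rightarrow> real ^ 'n \<Rightarrow> real ^ 'n \<Rightarrow> real ^ 'n::finite" where
  "fvct s r y = lim (\<lambda>t. matrix_power (adjacency s r y) t *v y)"

definition condensation :: "('a, 'b) pre_digraph \<Rightarrow> ('a, 'b) pre_digraph pair_pre_digraph" where
  "condensation G =
    \<lparr>pverts = pre_digraph.sccs G,
     parcs = {(H1, H2). H1 \<in> pre_digraph.sccs G \<and> H2 \<in> pre_digraph.sccs G \<and> H1 \<noteq> H2 \<and>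
                (\<exists>u \<in> verts H1. \<exists>v \<in> verts H2. (u, v) \<in> arcs_ends G)}\<rparr>"

definition sink :: "('a, 'b) pre_digraph \<Rightarrow> 'a \<Rightarrow> bool" where
  "sink G v \<longleftrightarrow> v \<in> verts G \<and> out_degree G v = 0"

text \<open>
  Completeness includes the self-loops, so the library's loop-free \<open>complete_digraph\<close> does
  not apply.
\<close>

definition complete_with_loops :: "('a, 'b) pre_digraph \<Rightarrow> bool" where
  "complete_with_loops H \<longleftrightarrow> (\<forall>u \<in> verts H. \<forall>v \<in> verts H. (u, v) \<in> arcs_ends H)"

definition moderate_minded_component ::
    "sync_system \<Rightarrow> real ^ 'n \<Rightarrow> real ^ 'n \<Rightarrow> ('n::finite, 'n \<times> 'n) pre_digraph \<Rightarrow> bool" where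
  "moderate_minded_component s r y H \<longleftrightarrow>
    H \<in> pre_digraph.sccs (with_proj (proximity_digraph s r y)) \<and>
    \<not> complete_with_loops H \<and>
    sink (with_proj (condensation (with_proj (proximity_digraph s r y)))) H"

definition predecessor ::
    "sync_system \<Rightarrow> real ^ 'n \<Rightarrow> real ^ 'n \<Rightarrow> 'n \<Rightarrow> 'n::finite \<Rightarrow> bool" where
  "predecessor s r y j i \<longleftrightarrow> j \<rightarrow>\<^sup>*\<^bsub>with_proj (proximity_digraph s r y)\<^esub> i"

text \<open>
  The minimum is a genuine one as soon as there are two agents. For a single agent it ranges over
  the empty set, and \<open>et_dist\<close> is then an unspecified real number.
\<close>

definition et_dist :: "real ^ 'n \<Rightarrow> real ^ 'n \<Rightarrow> real ^ 'n::finite" where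
  "et_dist r z =
    (\<chi> i. 0.5 * Min {\<bar>\<bar>z $ i - z $ j\<bar> - R\<bar> | j R. j \<in> UNIV - {i} \<and> R \<in> {r $ i, r $ j}})"

definition iet_dist :: "sync_system \<Rightarrow> real ^ 'n \<Rightarrow> real ^ 'n \<Rightarrow> real ^ 'n::finite" where
  "iet_dist s r z = (\<chi> i. Min {et_dist r z $ j | j. predecessor s r z j i})"

definition et_nbhd :: "real ^ 'n \<Rightarrow> real ^ 'n \<Rightarrow> (real ^ 'n::finite) set" where
  "et_nbhd r z =
    {y. \<forall>i. (et_dist r z $ i > 0 \<longrightarrow> \<bar>y $ i - z $ i\<bar> < et_dist r z $ i) \<and>
            (et_dist r z $ i = 0 \<longrightarrow> \<bar>y $ i - z $ i\<bar> = et_dist r z $ i)}"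

definition iet_nbhd :: "sync_system \<Rightarrow> real ^ 'n \<Rightarrow> real ^ 'n \<Rightarrow> (real ^ 'n::finite) set" where
  "iet_nbhd s r z =
    {y. \<forall>i. (iet_dist s r z $ i > 0 \<longrightarrow> \<bar>y $ i - z $ i\<bar> < iet_dist s r z $ i) \<and>
            (iet_dist s r z $ i = 0 \<longrightarrow> \<bar>y $ i - z $ i\<bar> = iet_dist s r z $ i)}"

end

theory Submission
  imports Defs
begin

text \<open>
  Every agent moves to the mean of its out-neighbors, and \<open>z\<close> is a fixed point of this averaging.
  Three observations drive the proof.

  \<^item> \<^emph>\<open>The topology never changes.\<close> Since \<open>et_dist\<close> is half the gap to the nearest threshold, two agents
    that both move by less cannot close the gap between their distance and a threshold
    (\<open>out_neighbors_eq_of_et_nbhd\<close>). While the topology is that of \<open>z\<close>, the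
    displacement of \<open>i\<close> from \<open>z\<close> at the next step is at most the mean of the displacements of
    its out-neighbors. Every predecessor of \<open>i\<close> is a predecessor of each out-neighbor \<open>j\<close> of \<open>i\<close>, so
    \<open>iet_dist\<close> at \<open>j\<close> is at most its value at \<open>i\<close>, and \<open>iet_nbhd\<close> is invariant
    (\<open>iet_nbhd_invariant\<close>). Hence the trajectory is that of the fixed matrix belonging to \<open>z\<close>.

  \<^item> \<^emph>\<open>Closed classes of an equilibrium are complete.\<close> On a strongly connected set that no edge
    leaves, \<open>z\<close> equals its own neighborhood means, so by the maximum principle it is constant
    there (\<open>harmonic_constant_on_closed_class\<close>). Agents with equal opinions are neighbors because
    the bounds are positive. The sinks of the condensation are such sets.

  \<^item> \<^emph>\<open>Convergence.\<close> On a closed class all agents have the same neighborhood, thus share the same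
    value after one step and never move again. Let \<open>L i\<close> be the limit of the diameters of
    the tails of the trajectory of agent \<open>i\<close>. Since a mean oscillates at most as much as the mean
    of the oscillations, \<open>L\<close> lies below its neighborhood means. By the maximum principle, the
    maximum of \<open>L\<close> is attained on a closed class, where \<open>L\<close> vanishes
    (\<open>averaging_convergent\<close>). So every coordinate converges, and the limit is \<open>fvct\<close> because the
    trajectory consists of the iterates of one matrix.
\<close>

section \<open>Means over finite sets\<close>

definition mean :: "'a set \<Rightarrow> ('a \<Rightarrow> real) \<Rightarrow> real" where
  "mean S f = sum f S / real (card S)"

lemma mean_const: "finite S \<Longrightarrow> S \<noteq> {} \<Longrightarrow> mean S (\<lambda>_. c) = c"
  by (simp add: mean_def)

lemma mean_mono: "(\<And>j. j \<in> S \<Longrightarrow> f j \<le> g j) \<Longrightarrow> mean S f \<le> mean S g"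
  by (simp add: mean_def sum_mono divide_right_mono)

lemma mean_cong: "(\<And>j. j \<in> S \<Longrightarrow> f j = g j) \<Longrightarrow> mean S f = mean S g"
  by (simp add: mean_def)

lemma abs_mean_diff_le: "\<bar>mean S f - mean S g\<bar> \<le> mean S (\<lambda>j. \<bar>f j - g j\<bar>)"
proof -
  have "\<bar>mean S f - mean S g\<bar> = \<bar>\<Sum>j\<in>S. f j - g j\<bar> / real (card S)"
    by (simp add: mean_def sum_subtractf diff_divide_distrib[symmetric])
  also have "\<dots> \<le> mean S (\<lambda>j. \<bar>f j - g j\<bar>)"
    by (simp add: mean_def divide_right_mono sum_abs)
  finally show ?thesis .
qed

lemma mean_less:
  assumes "finite S" "S \<noteq> {}" "\<And>j. j \<in> S \<Longrightarrow> f j < c"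
  shows "mean S f < c"
proof -
  have "sum f S < (\<Sum>j\<in>S. c)" using assms by (intro sum_strict_mono) auto
  then show ?thesis using assms by (simp add: mean_def divide_less_eq mult.commute card_gt_0_iff)
qed

lemma mean_attains_bound:
  assumes "finite S" "\<And>j. j \<in> S \<Longrightarrow> f j \<le> c" "c \<le> mean S f" "k \<in> S"
  shows "f k = c"
proof (rule ccontr)
  assume "f k \<noteq> c"
  then have "f k < c" using assms by (simp add: order_less_le)
  then have "sum f S < (\<Sum>j\<in>S. c)" using assms by (intro sum_strict_mono_ex1) auto
  moreover have "0 < card S" using assms by (auto simp: card_gt_0_iff)
  ultimately have "mean S f < c" by (simp add: mean_def divide_less_eq mult.commute)
  then show False using assms by simp
qed

section \<open>The maximum principle along a neighborhood relation\<close>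

abbreviation nbr_rel :: "('a \<Rightarrow> 'a set) \<Rightarrow> ('a \<times> 'a) set" where
  "nbr_rel N \<equiv> {(i, j). j \<in> N i}"

definition closed_class :: "('a \<Rightarrow> 'a set) \<Rightarrow> 'a set \<Rightarrow> bool" where
  "closed_class N T \<longleftrightarrow>
    T \<noteq> {} \<and> (\<forall>i\<in>T. N i \<subseteq> T) \<and> (\<forall>i\<in>T. \<forall>j\<in>T. (i, j) \<in> (nbr_rel N)\<^sup>*)"

text \<open>
  A value that is at most the mean of values none of which exceeds it is equal to all of them. So a
  maximum of a function below its neighborhood means spreads along edges.
\<close>

lemma subharmonic_max_propagates:
  fixes u :: "'a::finite \<Rightarrow> real"
  assumes reach: "(m, k) \<in> (nbr_rel N)\<^sup>*"
    and "m \<in> T"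
    and closed: "\<And>i. i \<in> T \<Longrightarrow> N i \<subseteq> T"
    and sub: "\<And>i. i \<in> T \<Longrightarrow> u i \<le> mean (N i) u"
    and max: "\<And>i. i \<in> T \<Longrightarrow> u i \<le> u m"
  shows "u k = u m \<and> k \<in> T"
  using reach
proof induction
  case base
  then show ?case using \<open>m \<in> T\<close> by simp
next
  case (step i j)
  then have i: "i \<in> T" "u i = u m" and j: "j \<in> N i" by auto
  have "u j = u m"
    using mean_attains_bound[of "N i" u "u m" j] sub[OF i(1)] i j closed[OF i(1)] max
    by (auto simp: subset_iff)
  then show ?case using closed i j by auto
qed

lemma harmonic_constant_on_closed_class:
  fixes u :: "'a::finite \<Rightarrow> real"
  assumes T: "closed_class N T"
    and harm: "\<And>i. i \<in> T \<Longrightarrow> u i = mean (N i) u"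
    and ij: "i \<in> T" "j \<in> T"
  shows "u i = u j"
proof -
  have "Max (u ` T) \<in> u ` T" using T by (intro Max_in) (auto simp: closed_class_def)
  then obtain m where m: "m \<in> T" "u m = Max (u ` T)" by auto
  have "u k = u m" if "k \<in> T" for k
    using subharmonic_max_propagates[of m k N T u] T harm m that
    by (auto simp: closed_class_def)
  then show ?thesis using ij by simp
qed

text \<open>
  Among the nodes reachable from \<open>i\<close>, one with the fewest reachable nodes can be reached back from
  everything that it reaches.
\<close>

lemma reaches_closed_class:
  fixes i :: "'a::finite"
  obtains T where "closed_class N T" "T \<subseteq> (nbr_rel N)\<^sup>* `` {i}"
proof -
  let ?R = "nbr_rel N"
  let ?reach = "\<lambda>k. ?R\<^sup>* `` {k}"
  have "\<exists>k. (i, k) \<in> ?R\<^sup>* \<and> (\<forall>l. (i, l) \<in> ?R\<^sup>* \<longrightarrow> card (?reach k) \<le> card (?reach l))"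
    using ex_has_least_nat[of "\<lambda>k. (i, k) \<in> ?R\<^sup>*" i "\<lambda>k. card (?reach k)"] by auto
  then obtain k where k: "(i, k) \<in> ?R\<^sup>*"
    and least: "\<And>l. (i, l) \<in> ?R\<^sup>* \<Longrightarrow> card (?reach k) \<le> card (?reach l)" by blast
  have ret: "(l, k) \<in> ?R\<^sup>*" if l: "(k, l) \<in> ?R\<^sup>*" for l
  proof -
    have "?reach l \<subseteq> ?reach k" using l by (auto intro: rtrancl_trans)
    moreover have "card (?reach k) \<le> card (?reach l)"
      using least[of l] k l by (meson rtrancl_trans)
    ultimately have "?reach l = ?reach k" by (intro card_seteq) auto
    then show ?thesis by auto
  qed
  show thesis
  proof
    show "closed_class N (?reach k)"
      unfolding closed_class_def
    proof (intro conjI ballI)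
      show "?reach k \<noteq> {}" by auto
    next
      fix a assume "a \<in> ?reach k"
      then show "N a \<subseteq> ?reach k" by (auto intro: rtrancl_into_rtrancl)
    next
      fix a b assume "a \<in> ?reach k" "b \<in> ?reach k"
      then show "(a, b) \<in> ?R\<^sup>*" using ret[of a] by (auto intro: rtrancl_trans)
    qed
    show "?reach k \<subseteq> ?reach i" using k by (auto intro: rtrancl_trans)
  qed
qed

section \<open>Convergence of averaging with a fixed neighborhood relation\<close>

lemma tail_diameter_convergent:
  fixes X :: "nat \<Rightarrow> real"
  assumes "bounded (range X)"
  shows "convergent (\<lambda>t. diameter (X ` {t..}))"
proof -
  have bd: "bounded (X ` {t..})" for t
    using assms by (rule bounded_subset) auto
  have "decseq (\<lambda>t. diameter (X ` {t..}))"
    unfolding decseq_def by (intro allI impI diameter_subset image_mono bd) auto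
  then show ?thesis
    using decseq_convergent[of _ 0] diameter_ge_0[OF bd] by (meson convergentI)
qed

lemma convergent_iff_tail_diameter:
  fixes X :: "nat \<Rightarrow> real"
  assumes "bounded (range X)"
  shows "convergent X \<longleftrightarrow> (\<lambda>t. diameter (X ` {t..})) \<longlonglongrightarrow> 0"
proof
  have bd: "bounded (X ` {t..})" for t
    using assms by (rule bounded_subset) auto
  show "(\<lambda>t. diameter (X ` {t..})) \<longlonglongrightarrow> 0" if "convergent X"
  proof (rule LIMSEQ_I)
    fix e :: real assume "0 < e"
    have "Cauchy X" using that by (simp add: Cauchy_convergent_iff)
    then obtain M where M: "\<And>m n. m \<ge> M \<Longrightarrow> n \<ge> M \<Longrightarrow> norm (X m - X n) < e / 2"
      using CauchyD half_gt_zero[OF \<open>0 < e\<close>] by blast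
    have half: "diameter (X ` {t..}) \<le> e / 2" if "t \<ge> M" for t
      using M that \<open>0 < e\<close> by (intro diameter_le) (auto intro!: less_imp_le)
    have "norm (diameter (X ` {t..}) - 0) < e" if "t \<ge> M" for t
      using half[OF that] diameter_ge_0[OF bd[of t]] \<open>0 < e\<close> by simp
    then show "\<exists>M. \<forall>t\<ge>M. norm (diameter (X ` {t..}) - 0) < e" by blast
  qed
  show "convergent X" if lim: "(\<lambda>t. diameter (X ` {t..})) \<longlonglongrightarrow> 0"
    unfolding Cauchy_convergent_iff[symmetric]
  proof (rule CauchyI)
    fix e :: real assume "0 < e"
    then obtain M where M: "diameter (X ` {M..}) < e"
      using LIMSEQ_D[OF lim, of e] by (auto simp: abs_less_iff)
    have "norm (X m - X n) < e" if "m \<ge> M" "n \<ge> M" for m n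
      using diameter_bounded_bound[OF bd[of M], of "X m" "X n"] M that
      by (auto simp: dist_norm)
    then show "\<exists>M. \<forall>m\<ge>M. \<forall>n\<ge>M. norm (X m - X n) < e" by blast
  qed
qed

lemma averaging_bounded:
  fixes x :: "nat \<Rightarrow> 'a::finite \<Rightarrow> real"
  assumes N: "\<And>i. N i \<noteq> {}"
    and step: "\<And>t i. x (Suc t) i = mean (N i) (x t)"
  shows "bounded (range (\<lambda>t. x t i))"
proof -
  have "\<bar>x t i\<bar> \<le> Max (range (\<lambda>j. \<bar>x 0 j\<bar>))" for t i
  proof (induction t arbitrary: i)
    case (Suc t)
    have "\<bar>x (Suc t) i\<bar> \<le> mean (N i) (\<lambda>j. \<bar>x t j\<bar>)"
      using abs_mean_diff_le[of "N i" "x t" "\<lambda>_. 0"] by (simp add: step mean_def)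
    also have "\<dots> \<le> mean (N i) (\<lambda>_. Max (range (\<lambda>j. \<bar>x 0 j\<bar>)))"
      using Suc by (intro mean_mono)
    finally show ?case using N by (simp add: mean_const)
  qed simp
  then show ?thesis by (auto simp: bounded_iff)
qed

text \<open>
  Each coordinate has a limiting oscillation, the limit of its tail diameters. Averaging does not
  increase oscillation, so the limiting oscillations lie below their neighborhood means, and the
  maximum principle carries their maximum into a closed class, where convergence makes it zero.
\<close>

lemma averaging_convergent:
  fixes x :: "nat \<Rightarrow> 'a::finite \<Rightarrow> real"
  assumes N: "\<And>i. N i \<noteq> {}"
    and step: "\<And>t i. x (Suc t) i = mean (N i) (x t)"
    and closed_conv: "\<And>T k. closed_class N T \<Longrightarrow> k \<in> T \<Longrightarrow> convergent (\<lambda>t. x t k)"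
  shows "convergent (\<lambda>t. x t i)"
proof -
  note bdd = averaging_bounded[of N x, OF N step]
  define D where "D = (\<lambda>i t. diameter ((\<lambda>t. x t i) ` {t..}))"
  define L where "L = (\<lambda>i. lim (D i))"
  have lim: "D i \<longlonglongrightarrow> L i" for i
    using tail_diameter_convergent[OF bdd[of i]]
    by (simp add: D_def L_def convergent_LIMSEQ_iff)
  have conv_iff: "convergent (\<lambda>t. x t i) \<longleftrightarrow> L i = 0" for i
    using convergent_iff_tail_diameter[OF bdd[of i]] lim[of i]
    by (auto simp: D_def dest: LIMSEQ_unique)
  have osc: "D i (Suc t) \<le> mean (N i) (\<lambda>j. D j t)" for i t
    unfolding D_def
  proof (rule diameter_le)
    have shift: "\<exists>p\<ge>t. a = x (Suc p) i" if "a \<in> (\<lambda>t. x t i) ` {Suc t..}" for a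
    proof -
      from that obtain q where q: "a = x q i" "Suc t \<le> q" by auto
      then obtain p where "q = Suc p" by (cases q) auto
      then show ?thesis using q by auto
    qed
    fix a b assume "a \<in> (\<lambda>t. x t i) ` {Suc t..}" "b \<in> (\<lambda>t. x t i) ` {Suc t..}"
    then obtain p q where pq: "a = x (Suc p) i" "b = x (Suc q) i" "t \<le> p" "t \<le> q"
      using shift by meson
    have "norm (a - b) \<le> mean (N i) (\<lambda>j. \<bar>x p j - x q j\<bar>)"
      using abs_mean_diff_le by (simp add: pq step)
    also have "\<dots> \<le> mean (N i) (\<lambda>j. diameter ((\<lambda>t. x t j) ` {t..}))"
    proof (rule mean_mono)
      fix j
      have "bounded ((\<lambda>t. x t j) ` {t..})" using bdd by (rule bounded_subset) auto
      from diameter_bounded_bound[OF this, of "x p j" "x q j"]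
      show "\<bar>x p j - x q j\<bar> \<le> diameter ((\<lambda>t. x t j) ` {t..})"
        using pq by (auto simp: dist_norm)
    qed
    finally show "norm (a - b) \<le> mean (N i) (\<lambda>j. diameter ((\<lambda>t. x t j) ` {t..}))" .
  qed auto
  have sub: "L i \<le> mean (N i) L" for i
  proof (rule LIMSEQ_le)
    show "(\<lambda>t. D i (Suc t)) \<longlonglongrightarrow> L i" using lim by (rule LIMSEQ_Suc)
    show "(\<lambda>t. mean (N i) (\<lambda>j. D j t)) \<longlonglongrightarrow> mean (N i) L"
      unfolding mean_def by (intro tendsto_intros lim) (simp add: N)
  qed (use osc in auto)
  have "Max (range L) \<in> range L" by (intro Max_in) auto
  then obtain m where "Max (range L) = L m" by (rule rangeE)
  then have m: "L j \<le> L m" for j by (metis Max_ge finite_class.finite finite_imageI rangeI)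
  obtain T where T: "closed_class N T" "T \<subseteq> (nbr_rel N)\<^sup>* `` {m}" by (rule reaches_closed_class)
  then obtain k where k: "k \<in> T" "(m, k) \<in> (nbr_rel N)\<^sup>*" by (auto simp: closed_class_def)
  have "L k = L m" using subharmonic_max_propagates[of m k N UNIV L] k sub m by simp
  moreover have "L k = 0" using closed_conv T k conv_iff by blast
  ultimately have "L i \<le> 0" using m[of i] by simp
  moreover have "0 \<le> L i"
  proof (rule LIMSEQ_le_const[OF lim])
    have "0 \<le> D i t" for t
      unfolding D_def by (intro diameter_ge_0 bounded_subset[OF bdd]) auto
    then show "\<exists>M. \<forall>t\<ge>M. 0 \<le> D i t" by blast
  qed
  ultimately show ?thesis using conv_iff by simp
qed

section \<open>Topology near an opinion vector\<close>

lemma self_in_out_neighbors: "0 < r $ i \<Longrightarrow> i \<in> out_neighbors s r y i"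
  by (cases s) (simp_all add: out_neighbors_def)

lemma adjacency_mult_eq_mean:
  "(adjacency s r y *v u) $ i = mean (out_neighbors s r y i) (($) u)"
proof -
  have "(adjacency s r y *v u) $ i
      = (\<Sum>j\<in>UNIV. if j \<in> out_neighbors s r y i
           then u $ j / real (card (out_neighbors s r y i)) else 0)"
    by (auto simp: adjacency_def matrix_vector_mult_def intro!: sum.cong)
  also have "\<dots> = mean (out_neighbors s r y i) (($) u)"
    by (simp add: sum.If_cases mean_def sum_divide_distrib)
  finally show ?thesis .
qed

lemma finite_gaps:
  fixes r z :: "real ^ 'n::finite"
  shows "finite {\<bar>\<bar>z $ i - z $ j\<bar> - R\<bar> | j R. j \<in> UNIV - {i} \<and> R \<in> {r $ i, r $ j}}"
proof (rule finite_subset)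
  show "{\<bar>\<bar>z $ i - z $ j\<bar> - R\<bar> | j R. j \<in> UNIV - {i} \<and> R \<in> {r $ i, r $ j}}
      \<subseteq> (\<lambda>(j, R). \<bar>\<bar>z $ i - z $ j\<bar> - R\<bar>) ` (UNIV \<times> range (($) r))"
    by auto
qed auto

lemma et_dist_le_gap:
  fixes r z :: "real ^ 'n::finite"
  assumes "i \<noteq> j" "R \<in> {r $ i, r $ j}"
  shows "2 * et_dist r z $ i \<le> \<bar>\<bar>z $ i - z $ j\<bar> - R\<bar>"
proof -
  have "Min {\<bar>\<bar>z $ i - z $ j\<bar> - R\<bar> | j R. j \<in> UNIV - {i} \<and> R \<in> {r $ i, r $ j}}
      \<le> \<bar>\<bar>z $ i - z $ j\<bar> - R\<bar>"
    using assms by (intro Min_le finite_gaps) blast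
  then show ?thesis by (simp add: et_dist_def)
qed

lemma et_dist_nonneg:
  fixes r z :: "real ^ 'n::finite"
  assumes "i \<noteq> j"
  shows "0 \<le> et_dist r z $ i"
proof -
  let ?G = "{\<bar>\<bar>z $ i - z $ j\<bar> - R\<bar> | j R. j \<in> UNIV - {i} \<and> R \<in> {r $ i, r $ j}}"
  have "\<bar>\<bar>z $ i - z $ j\<bar> - r $ i\<bar> \<in> ?G" using assms by (intro CollectI exI) auto
  then have "?G \<noteq> {}" by (metis empty_iff)
  then have "Min ?G \<in> ?G" by (rule Min_in[OF finite_gaps])
  moreover have "\<forall>g\<in>?G. 0 \<le> g" by auto
  ultimately have "0 \<le> Min ?G" by (rule bspec[rotated])
  then show ?thesis by (simp add: et_dist_def)
qed

text \<open>
  A distance that equals its threshold forces \<open>et_dist = 0\<close> at both ends, hence is not moved at all.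
  Any other distance is moved by less than its gap to the threshold, since each end covers
  strictly less than half of it.
\<close>

lemma out_neighbors_eq_of_et_nbhd:
  fixes r z y :: "real ^ 'n::finite"
  assumes y: "y \<in> et_nbhd r z"
  shows "out_neighbors s r y = out_neighbors s r z"
proof -
  have thr: "\<bar>y $ i - y $ j\<bar> \<le> R \<longleftrightarrow> \<bar>z $ i - z $ j\<bar> \<le> R"
    if R: "R \<in> {r $ i, r $ j}" for i j R
  proof (cases "i = j")
    case False
    define gap where "gap = \<bar>\<bar>z $ i - z $ j\<bar> - R\<bar>"
    have e: "2 * et_dist r z $ i \<le> gap" "0 \<le> et_dist r z $ i"
      "2 * et_dist r z $ j \<le> gap" "0 \<le> et_dist r z $ j"
      using et_dist_le_gap[of i j R r z] et_dist_le_gap[of j i R r z] R False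
        et_dist_nonneg[of i j r z] et_dist_nonneg[of j i r z]
      by (auto simp: gap_def abs_minus_commute)
    have d: "et_dist r z $ k > 0 \<Longrightarrow> \<bar>y $ k - z $ k\<bar> < et_dist r z $ k"
      "et_dist r z $ k = 0 \<Longrightarrow> \<bar>y $ k - z $ k\<bar> = 0" for k
      using y by (auto simp: et_nbhd_def)
    have "\<bar>y $ i - z $ i\<bar> + \<bar>y $ j - z $ j\<bar> < gap
        \<or> y $ i = z $ i \<and> y $ j = z $ j"
      using e d(1)[of i] d(2)[of i] d(1)[of j] d(2)[of j] by linarith
    then show ?thesis unfolding gap_def by linarith
  qed simp
  show ?thesis
    by (intro ext) (cases s; auto simp: out_neighbors_def thr)
qed

section \<open>Invariance of the invariant equi-topology neighborhood\<close>

lemma predecessor_iff: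
  fixes r y :: "real ^ 'n::finite"
  shows "predecessor s r y j i \<longleftrightarrow> (j, i) \<in> (nbr_rel (out_neighbors s r y))\<^sup>*"
proof -
  have "rtrancl_on UNIV R = R\<^sup>*" for R :: "('n \<times> 'n) set"
  proof (intro equalityI subrelI)
    fix a b show "(a, b) \<in> rtrancl_on UNIV R \<Longrightarrow> (a, b) \<in> R\<^sup>*" by (rule rtrancl_on_rtranclI)
    show "(a, b) \<in> R\<^sup>* \<Longrightarrow> (a, b) \<in> rtrancl_on UNIV R"
      by (induction rule: rtrancl_induct) (auto intro: rtrancl_on_into_rtrancl_on)
  qed
  moreover have "arcs_ends (with_proj (proximity_digraph s r y)) = nbr_rel (out_neighbors s r y)"
    by (auto simp: arcs_ends_def arc_to_ends_def proximity_digraph_def with_proj_def image_iff)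
  ultimately show ?thesis
    by (simp add: predecessor_def reachable_def proximity_digraph_def)
qed

lemma iet_dist_le:
  assumes "predecessor s r z j i"
  shows "iet_dist s r z $ i \<le> et_dist r z $ j"
  using assms by (auto simp: iet_dist_def intro!: Min_le)

lemma iet_dist_attained:
  obtains j where "predecessor s r z j i" "iet_dist s r z $ i = et_dist r z $ j"
proof -
  let ?E = "{et_dist r z $ j | j. predecessor s r z j i}"
  have "predecessor s r z i i" by (simp add: predecessor_iff)
  then have "Min ?E \<in> ?E" by (intro Min_in) auto
  then obtain j where "predecessor s r z j i" "Min ?E = et_dist r z $ j" by blast
  then show thesis using that by (simp add: iet_dist_def)
qed

lemma iet_dist_nonneg:
  fixes z :: "real ^ 'n::finite"
  assumes "i \<noteq> (j :: 'n)"
  shows "0 \<le> iet_dist s r z $ k"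
proof -
  obtain p where "iet_dist s r z $ k = et_dist r z $ p" by (rule iet_dist_attained)
  moreover have "p \<noteq> i \<or> p \<noteq> j" using assms by auto
  ultimately show ?thesis using et_dist_nonneg by metis
qed

lemma iet_dist_antimono:
  assumes "j \<in> out_neighbors s r z i"
  shows "iet_dist s r z $ j \<le> iet_dist s r z $ i"
proof -
  obtain k where "predecessor s r z k i" "iet_dist s r z $ i = et_dist r z $ k"
    by (rule iet_dist_attained)
  moreover from this assms have "predecessor s r z k j"
    by (auto simp: predecessor_iff intro: rtrancl_into_rtrancl)
  ultimately show ?thesis using iet_dist_le by metis
qed

text \<open>
  With a single agent \<open>et_dist\<close> is an unspecified, possibly negative number. It then
  coincides with \<open>iet_dist\<close>; this is why the case of a unique agent is separated here and in the
  invariance proof.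
\<close>

lemma iet_nbhd_subset_et_nbhd:
  fixes z :: "real ^ 'n::finite"
  shows "iet_nbhd s r z \<subseteq> et_nbhd r z"
proof
  fix y assume y: "y \<in> iet_nbhd s r z"
  have "(et_dist r z $ i > 0 \<longrightarrow> \<bar>y $ i - z $ i\<bar> < et_dist r z $ i) \<and>
      (et_dist r z $ i = 0 \<longrightarrow> \<bar>y $ i - z $ i\<bar> = et_dist r z $ i)" for i
  proof -
    have yi: "iet_dist s r z $ i > 0 \<Longrightarrow> \<bar>y $ i - z $ i\<bar> < iet_dist s r z $ i"
      "iet_dist s r z $ i = 0 \<Longrightarrow> \<bar>y $ i - z $ i\<bar> = 0"
      using y by (auto simp: iet_nbhd_def)
    have le: "iet_dist s r z $ i \<le> et_dist r z $ i"
      by (rule iet_dist_le) (simp add: predecessor_iff)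
    show ?thesis
    proof (cases "\<exists>j. j \<noteq> i")
      case True
      then have "0 \<le> iet_dist s r z $ i" using iet_dist_nonneg by metis
      then show ?thesis using yi le by linarith
    next
      case False
      obtain j where "iet_dist s r z $ i = et_dist r z $ j" by (rule iet_dist_attained)
      then have "iet_dist s r z $ i = et_dist r z $ i" using False by metis
      then show ?thesis using yi by auto
    qed
  qed
  then show "y \<in> et_nbhd r z" by (simp add: et_nbhd_def)
qed

text \<open>
  With common neighborhoods, the displacement of \<open>i\<close> from \<open>z\<close> after one step is bounded by the mean
  displacement of the out-neighbors of \<open>i\<close>, whose tolerances are no larger than that of \<open>i\<close>.
\<close>

lemma iet_nbhd_invariant:
  fixes r z y :: "real ^ 'n::finite"
  assumes r_pos: "\<forall>i. 0 < r $ i"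
    and equi: "equilibrium s r z"
    and y: "y \<in> iet_nbhd s r z"
  shows "adjacency s r y *v y \<in> iet_nbhd s r z"
proof -
  let ?y' = "adjacency s r y *v y" and ?\<delta> = "iet_dist s r z"
  have nbrs: "out_neighbors s r y = out_neighbors s r z"
    using y iet_nbhd_subset_et_nbhd out_neighbors_eq_of_et_nbhd by blast
  have yj: "?\<delta> $ j > 0 \<Longrightarrow> \<bar>y $ j - z $ j\<bar> < ?\<delta> $ j"
    "?\<delta> $ j = 0 \<Longrightarrow> \<bar>y $ j - z $ j\<bar> = 0" for j
    using y by (auto simp: iet_nbhd_def)
  have "(?\<delta> $ i > 0 \<longrightarrow> \<bar>?y' $ i - z $ i\<bar> < ?\<delta> $ i) \<and>
      (?\<delta> $ i = 0 \<longrightarrow> \<bar>?y' $ i - z $ i\<bar> = ?\<delta> $ i)" for i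
  proof -
    let ?N = "out_neighbors s r z i"
    have N: "?N \<noteq> {}" using self_in_out_neighbors r_pos by blast
    have "z $ i = mean ?N (($) z)"
      using equi adjacency_mult_eq_mean[of s r z z i] by (simp add: equilibrium_def)
    then have le: "\<bar>?y' $ i - z $ i\<bar> \<le> mean ?N (\<lambda>j. \<bar>y $ j - z $ j\<bar>)"
      using abs_mean_diff_le[of ?N "($) y" "($) z"] by (simp add: adjacency_mult_eq_mean nbrs)
    have tol: "?\<delta> $ j \<le> ?\<delta> $ i" "j = i \<or> 0 \<le> ?\<delta> $ j" if "j \<in> ?N" for j
      using that iet_dist_antimono iet_dist_nonneg by blast+
    show ?thesis
    proof (intro conjI impI)
      assume "?\<delta> $ i > 0"
      then have "\<bar>y $ j - z $ j\<bar> < ?\<delta> $ i" if "j \<in> ?N" for j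
        using tol[OF that] yj[of j] by fastforce
      then have "mean ?N (\<lambda>j. \<bar>y $ j - z $ j\<bar>) < ?\<delta> $ i" using N by (intro mean_less) auto
      then show "\<bar>?y' $ i - z $ i\<bar> < ?\<delta> $ i" using le by simp
    next
      assume 0: "?\<delta> $ i = 0"
      then have "\<bar>y $ j - z $ j\<bar> = 0" if "j \<in> ?N" for j
        using tol[OF that] yj[of j] by fastforce
      then have "mean ?N (\<lambda>j. \<bar>y $ j - z $ j\<bar>) = 0" by (simp add: mean_def)
      then show "\<bar>?y' $ i - z $ i\<bar> = ?\<delta> $ i" using le 0 by simp
    qed
  qed
  then show ?thesis by (simp add: iet_nbhd_def)
qed

section \<open>Closed classes of an equilibrium\<close>

lemma equilibrium_closed_class_complete:
  fixes r z :: "real ^ 'n::finite"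
  assumes r_pos: "\<forall>i. 0 < r $ i"
    and equi: "equilibrium s r z"
    and T: "closed_class (out_neighbors s r z) T"
    and i: "i \<in> T"
  shows "out_neighbors s r z i = T"
proof
  show "out_neighbors s r z i \<subseteq> T" using T i by (simp add: closed_class_def)
  show "T \<subseteq> out_neighbors s r z i"
  proof
    fix j assume "j \<in> T"
    have "z $ k = mean (out_neighbors s r z k) (($) z)" for k
      using equi adjacency_mult_eq_mean[of s r z z k] by (simp add: equilibrium_def)
    then have "z $ i = z $ j"
      using harmonic_constant_on_closed_class[OF T] i \<open>j \<in> T\<close> by blast
    then show "j \<in> out_neighbors s r z i"
      using r_pos by (cases s) (auto simp: out_neighbors_def less_imp_le)
  qed
qed

lemma sink_scc_closed_class:
  fixes s :: sync_system and r y :: "real ^ 'n::finite"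
  defines "G \<equiv> with_proj (proximity_digraph s r y)"
  assumes H: "H \<in> pre_digraph.sccs G"
    and sink: "sink (with_proj (condensation G)) H"
  shows "closed_class (out_neighbors s r y) (verts H)"
proof -
  interpret fin_digraph G
    by unfold_locales (auto simp: G_def proximity_digraph_def)
  have reach: "u \<rightarrow>\<^sup>*\<^bsub>G\<^esub> v \<longleftrightarrow> (u, v) \<in> (nbr_rel (out_neighbors s r y))\<^sup>*" for u v
    using predecessor_iff[of s r y u v] by (simp add: predecessor_def G_def)
  have arc: "(u, v) \<in> arcs_ends G" if "v \<in> out_neighbors s r y u" for u v
    using that by (auto simp: arcs_ends_def arc_to_ends_def G_def proximity_digraph_def
        with_proj_def image_iff)
  have HV: "verts H \<in> sccs_verts" using H by (simp add: in_sccs_vertsI_sccs)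
  then have sc: "verts H \<noteq> {}" "\<And>u v. u \<in> verts H \<Longrightarrow> v \<in> verts H \<Longrightarrow> u \<rightarrow>\<^sup>*\<^bsub>G\<^esub> v"
    by (auto simp: in_sccs_verts_conv_reachable)
  have "v \<in> verts H" if u: "u \<in> verts H" and v: "v \<in> out_neighbors s r y u" for u v
  proof (rule ccontr)
    assume "v \<notin> verts H"
    define K where "K = G \<restriction> scc_of v"
    have vG: "v \<in> verts G" by (simp add: G_def proximity_digraph_def)
    then have K: "K \<in> sccs" "v \<in> verts K"
      using scc_of_in_sccs_verts in_verts_sccsD_sccs in_scc_of_self by (auto simp: K_def)
    let ?C = "with_proj (condensation G)"
    have "(H, K) \<in> out_arcs ?C H"
      using H K u v arc \<open>v \<notin> verts H\<close>
      by (auto simp: out_arcs_def condensation_def with_proj_def)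
    \<comment> \<open>The out-degree is a cardinality, so its vanishing excludes arcs only once finiteness is known.\<close>
    moreover have "finite (out_arcs ?C H)"
    proof (rule finite_subset)
      show "out_arcs ?C H \<subseteq> sccs \<times> sccs"
        by (auto simp: out_arcs_def condensation_def with_proj_def)
      show "finite (sccs \<times> sccs)"
        using finite_sccs_verts by (simp add: sccs_conv_sccs_verts)
    qed
    ultimately have "out_degree ?C H \<noteq> 0"
      by (metis card_eq_0_iff empty_iff out_degree_def)
    then show False using sink by (simp add: sink_def)
  qed
  then show ?thesis
    using sc by (auto simp: closed_class_def reach)
qed

lemma equilibrium_no_moderate_minded_component:
  fixes r z :: "real ^ 'n::finite"
  assumes r_pos: "\<forall>i. 0 < r $ i" and equi: "equilibrium s r z"
  shows "\<not> moderate_minded_component s r z H"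
proof
  let ?G = "with_proj (proximity_digraph s r z)"
  assume "moderate_minded_component s r z H"
  then have H: "H \<in> pre_digraph.sccs ?G" "\<not> complete_with_loops H"
    "sink (with_proj (condensation ?G)) H"
    by (auto simp: moderate_minded_component_def)
  have T: "closed_class (out_neighbors s r z) (verts H)"
    using H by (intro sink_scc_closed_class)
  have ind: "induced_subgraph H ?G" using H(1) by (simp add: pre_digraph.sccs_def)
  have "(u, v) \<in> arcs_ends H" if uv: "u \<in> verts H" "v \<in> verts H" for u v
  proof -
    have "v \<in> out_neighbors s r z u"
      using equilibrium_closed_class_complete[OF r_pos equi T uv(1)] uv(2) by simp
    then have "(u, v) \<in> arcs H" "tail H = fst" "head H = snd"
      using ind uv by (auto simp: induced_subgraph_def subgraph_def compatible_def
          proximity_digraph_def with_proj_def arcs_ends_def arc_to_ends_def image_iff)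
    then show ?thesis by (force simp: arcs_ends_def arc_to_ends_def)
  qed
  then show False using H(2) by (simp add: complete_with_loops_def)
qed

section \<open>The trajectory\<close>

lemma matrix_power_Suc_mult:
  "matrix_power A (Suc t) *v y = A *v (matrix_power A t *v y)"
  by (simp add: matrix_power_def matrix_vector_mul_assoc)

theorem theorem4p4:
  fixes s :: sync_system
    and r :: "real ^ 'n::finite"
    and z :: "real ^ 'n"
    and x :: "nat \<Rightarrow> real ^ 'n"
  assumes r_pos: "\<forall>i. 0 < r $ i"
    and traj: "trajectory s r x"
    and equi: "equilibrium s r z"
    and init: "x 0 \<in> iet_nbhd s r z"
  shows "(\<forall>t. x t \<in> et_nbhd r z \<and> proximity_digraph s r z = proximity_digraph s r (x t))
    \<and> (\<forall>t. \<not> (\<exists>H. moderate_minded_component s r (x t) H))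
    \<and> x \<longlonglongrightarrow> fvct s r (x 0)"
proof -
  let ?N = "out_neighbors s r z"
  have step: "x (Suc t) = adjacency s r (x t) *v x t" for t
    using traj by (simp add: trajectory_def)
  have iet: "x t \<in> iet_nbhd s r z" for t
    by (induction t) (simp_all add: init step iet_nbhd_invariant[OF r_pos equi])
  then have et: "x t \<in> et_nbhd r z" for t using iet_nbhd_subset_et_nbhd by blast
  then have nbrs: "out_neighbors s r (x t) = ?N" for t by (rule out_neighbors_eq_of_et_nbhd)
  then have graph: "proximity_digraph s r (x t) = proximity_digraph s r z" for t
    by (simp add: proximity_digraph_def)
  have adj: "adjacency s r (x t) = adjacency s r z" for t
    by (simp only: adjacency_def nbrs)
  have no_mod: "\<not> moderate_minded_component s r (x t) H" for t H
    using equilibrium_no_moderate_minded_component[OF r_pos equi, of H]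
    by (simp add: moderate_minded_component_def graph)

  have avg: "x (Suc t) $ i = mean (?N i) (($) (x t))" for t i
    by (simp add: step adjacency_mult_eq_mean nbrs)
  have nonempty: "?N i \<noteq> {}" for i using self_in_out_neighbors r_pos by blast
  have "convergent (\<lambda>t. x t $ i)" for i
  proof (rule averaging_convergent[where N = ?N and x = "\<lambda>t. ($) (x t)", OF nonempty avg])
    fix T k assume T: "closed_class ?N T" and k: "k \<in> T"
    have N: "?N j = T" if "j \<in> T" for j
      by (rule equilibrium_closed_class_complete[OF r_pos equi T that])
    have stays: "x (Suc (Suc t)) $ k = x (Suc t) $ k" for t
    proof -
      have "x (Suc (Suc t)) $ k = mean T (($) (x (Suc t)))"
        by (simp only: avg[of "Suc t" k] N[OF k])
      also have "\<dots> = mean T (\<lambda>_. x (Suc t) $ k)" by (rule mean_cong) (simp add: avg N k)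
      also have "\<dots> = x (Suc t) $ k" using k by (intro mean_const) auto
      finally show ?thesis .
    qed
    have "x (Suc t) $ k = x (Suc 0) $ k" for t by (induction t) (simp_all add: stays)
    then have "(\<lambda>t. x (Suc t) $ k) = (\<lambda>_. x (Suc 0) $ k)" by blast
    then have "convergent (\<lambda>t. x (Suc t) $ k)" by (simp add: convergent_const)
    then show "convergent (\<lambda>t. x t $ k)"
      using convergent_Suc_iff[of "\<lambda>t. x t $ k"] by simp
  qed
  then have "(\<lambda>t. x t $ i) \<longlonglongrightarrow> lim (\<lambda>t. x t $ i)" for i
    by (simp add: convergent_LIMSEQ_iff)
  then have lim: "x \<longlonglongrightarrow> (\<chi> i. lim (\<lambda>t. x t $ i))" by (intro vec_tendstoI) simp
  have "matrix_power (adjacency s r (x 0)) t *v x 0 = x t" for t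
    by (induction t) (simp add: matrix_power_def, simp add: matrix_power_Suc_mult step adj)
  then have "fvct s r (x 0) = lim x" by (simp add: fvct_def)
  then have "x \<longlonglongrightarrow> fvct s r (x 0)" using lim by (simp add: limI)
  then show ?thesis using et graph no_mod by simp
qed

end
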